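(* There exists a modular $T_0$-space $(X,\tau,\alpha)$ such that $(X,\le)$, where $\le$ is the specialisation order, is not a directed complete partial order.
   Context: $W_e$ denotes the $e$-th c.e. set. A topological space $(X,\tau,\alpha)$ with $\alpha:\omega\to$ (a base of $\tau$) is effectively enumerable if (1) there is a computable $g$ with $\alpha(i)\cap\alpha(j)=\bigcup_{n}\alpha(g(i,j,n))$, and (2) $\{i\mid\alpha(i)\neq\emptyset\}$ is c.e. Effectively open set: $\bigcup_{n\in V}\alpha(n)$ with $V$ c.e.; a sequence $\{\mathcal{O}_n\}$ of such sets is computable if $\mathcal{O}_n=\bigcup_{k\in W_{f(n)}}\alpha(k)$ for a computable $f$. $A_x=\{n\mid x\in\alpha(n)\}$; $x$ is computable if $A_x$ is c.e.; $X_c$ is the set of computable elements; a sequence $\{a_n\}$ of computable elements is computable if $A_{a_n}=W_{f(n)}$ for a computable $f$; $\widehat{X_c}=\{A_a\mid a\in X_c\}$. A family $S$ of c.e. sets is a $wn$-family if there is a partial computable $\sigma$ with (i) $\sigma(n)\downarrow\Rightarrow W_{\sigma(n)}\in S$, (ii) $W_n\in S\Rightarrow n\in\mathrm{dom}(\sigma)$ and $W_{\sigma(n)}=W_n$. Specialisation order: $x\le y$ iff every open set containing $x$ contains $y$; $x\le\mathcal{O}$ means $x\le y$ for all $y\in\mathcal{O}$. A modular $T_0$-space is an effectively enumerable $T_0$-space such that (Req 1) $\widehat{X_c}$ is a $wn$-family and (Req 2) there are a computable sequence $\{b_n\}$ of computable elements and a computable sequence $\{\mathcal{O}_n\}$ of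 effectively open sets with $b_n\le\mathcal{O}_n$ for all $n$ and $\alpha(m)=\bigcup_{i\,:\,b_i\in\alpha(m)}\mathcal{O}_i$ for all $m$. A partial order is directed complete if every nonempty directed subset has a supremum. *)

theory Defs
  imports "HOL-Analysis.Abstract_Topological_Spaces" "HOL-Library.Nat_Bijection"
begin

section \<open>Partial recursive functions and c.e. sets\<close>

text \<open>
  Kleene's partial recursive functions in the standard unary presentation: tuples are coded by
  Cantor pairing, and the projections and tupling are basic operations.  (The identity is
  \<open>Pr Fst Snd\<close>.)
\<close>

datatype prog =
    Zero
  | Succ
  | Fst
  | Snd
  | Pr prog prog
  | Comp prog prog
  | PrimRec prog prog
  | Mu prog

text \<open>
  \<open>PrimRec p q\<close> denotes \<open>h\<close> with \<open>h (a, 0) = p a\<close> and \<open>h (a, n + 1) = q (a, n, h (a, n))\<close>.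
  \<open>Mu p\<close> denotes \<open>a \<mapsto> \<mu>y. p (a, y) = 0\<close>, where all \<open>p (a, z)\<close> with \<open>z < y\<close> must be defined.
\<close>

primrec eval :: "prog \<Rightarrow> nat \<Rightarrow> nat option" where
  "eval Zero = (\<lambda>x. Some 0)"
| "eval Succ = (\<lambda>x. Some (Suc x))"
| "eval Fst = (\<lambda>x. Some (fst (prod_decode x)))"
| "eval Snd = (\<lambda>x. Some (snd (prod_decode x)))"
| "eval (Pr p q) = (\<lambda>x. Option.bind (eval p x) (\<lambda>u.
     Option.bind (eval q x) (\<lambda>v. Some (prod_encode (u, v)))))"
| "eval (Comp p q) = (\<lambda>x. Option.bind (eval q x) (eval p))"
| "eval (PrimRec p q) = (\<lambda>x. case prod_decode x of (a, n) \<Rightarrow>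
     rec_nat (eval p a)
       (\<lambda>k r. Option.bind r (\<lambda>v. eval q (prod_encode (a, prod_encode (k, v))))) n)"
| "eval (Mu p) = (\<lambda>a.
     if \<exists>y. eval p (prod_encode (a, y)) = Some 0 \<and> (\<forall>z<y. eval p (prod_encode (a, z)) \<noteq> None)
     then Some (LEAST y. eval p (prod_encode (a, y)) = Some 0)
     else None)"

primrec goedel :: "prog \<Rightarrow> nat" where
  "goedel Zero = 0"
| "goedel Succ = 1"
| "goedel Fst = 2"
| "goedel Snd = 3"
| "goedel (Pr p q) = 4 * prod_encode (goedel p, goedel q) + 4"
| "goedel (Comp p q) = 4 * prod_encode (goedel p, goedel q) + 5"
| "goedel (PrimRec p q) = 4 * prod_encode (goedel p, goedel q) + 6"
| "goedel (Mu p) = 4 * goedel p + 7"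

lemma goedel_residues:
  fixes a b :: nat
  shows "4 * a + 4 \<noteq> 4 * b + 5" "4 * a + 4 \<noteq> 4 * b + 6" "4 * a + 4 \<noteq> 4 * b + 7"
    "4 * a + 5 \<noteq> 4 * b + 6" "4 * a + 5 \<noteq> 4 * b + 7" "4 * a + 6 \<noteq> 4 * b + 7"
  by presburger+

lemma inj_goedel: "goedel p = goedel q \<Longrightarrow> p = q"
proof (induction p arbitrary: q)
  case Zero then show ?case by (cases q) simp_all
next
  case Succ then show ?case by (cases q) simp_all
next
  case Fst then show ?case by (cases q) simp_all
next
  case Snd then show ?case by (cases q) simp_all
next
  case (Pr p1 p2) then show ?case
    by (cases q) (simp_all add: goedel_residues goedel_residues[symmetric])
next
  case (Comp p1 p2) then show ?case
    by (cases q) (simp_all add: goedel_residues goedel_residues[symmetric])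
next
  case (PrimRec p1 p2) then show ?case
    by (cases q) (simp_all add: goedel_residues goedel_residues[symmetric])
next
  case (Mu p) then show ?case
    by (cases q) (simp_all add: goedel_residues goedel_residues[symmetric])
qed

lemma surj_goedel: "\<exists>p. goedel p = n"
proof (induction n rule: less_induct)
  case (less n)
  show ?case
  proof (cases "n < 4")
    case True
    then have "n = 0 \<or> n = 1 \<or> n = 2 \<or> n = 3" by arith
    then show ?thesis
      using goedel.simps(1-4) by metis
  next
    case False
    define m where "m = (n - 4) div 4"
    have n: "n = 4 * m + 4 \<or> n = 4 * m + 5 \<or> n = 4 * m + 6 \<or> n = 4 * m + 7"
      using False unfolding m_def by presburger
    obtain a b where ab: "m = prod_encode (a, b)"
      by (metis prod_decode_inverse surj_pair)
    have "a < n" "b < n" "m < n"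
      using n ab le_prod_encode_1[of a b] le_prod_encode_2[of b a] by linarith+
    then obtain p q r where "goedel p = a" "goedel q = b" "goedel r = m"
      using less.IH by meson
    then show ?thesis
      using n ab goedel.simps(5-8) by metis
  qed
qed

lemma bij_goedel: "bij goedel"
proof (rule bijI)
  show "inj goedel" by (rule injI) (rule inj_goedel)
  show "surj goedel" unfolding surj_def using surj_goedel by (metis (full_types))
qed

text \<open>
  The numbering of programs is an effective bijection, so \<open>W\<close> is an acceptable numbering of the
  c.e. sets, these being the domains of the partial recursive functions.
\<close>

definition W :: "nat \<Rightarrow> nat set" where
  "W e = dom (eval (inv goedel e))"

definition ce :: "nat set \<Rightarrow> bool" where
  "ce A \<longleftrightarrow> (\<exists>e. A = W e)"

definition partial_computable :: "(nat \<Rightarrow> nat option) \<Rightarrow> bool" where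
  "partial_computable f \<longleftrightarrow> (\<exists>p. f = eval p)"

definition computable :: "(nat \<Rightarrow> nat) \<Rightarrow> bool" where
  "computable f \<longleftrightarrow> partial_computable (\<lambda>x. Some (f x))"

definition computable3 :: "(nat \<Rightarrow> nat \<Rightarrow> nat \<Rightarrow> nat) \<Rightarrow> bool" where
  "computable3 g \<longleftrightarrow>
     (\<exists>f. computable f \<and> (\<forall>i j n. g i j n = f (prod_encode (i, prod_encode (j, n)))))"

definition wn_family :: "nat set set \<Rightarrow> bool" where
  "wn_family S \<longleftrightarrow> (\<forall>A\<in>S. ce A) \<and>
     (\<exists>\<sigma>. partial_computable \<sigma> \<and>
        (\<forall>n m. \<sigma> n = Some m \<longrightarrow> W m \<in> S) \<and>
        (\<forall>n. W n \<in> S \<longrightarrow> (\<exists>m. \<sigma> n = Some m \<and> W m = W n)))"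

section \<open>Effectively enumerable and modular spaces\<close>

text \<open>The range of \<open>\<alpha>\<close> is a base of the topology.\<close>

definition enumerated_base :: "'a topology \<Rightarrow> (nat \<Rightarrow> 'a set) \<Rightarrow> bool" where
  "enumerated_base X \<alpha> \<longleftrightarrow> openin X = arbitrary union_of (\<lambda>U. U \<in> range \<alpha>)"

definition effectively_enumerable :: "'a topology \<Rightarrow> (nat \<Rightarrow> 'a set) \<Rightarrow> bool" where
  "effectively_enumerable X \<alpha> \<longleftrightarrow>
     enumerated_base X \<alpha> \<and>
     (\<exists>g. computable3 g \<and> (\<forall>i j. \<alpha> i \<inter> \<alpha> j = (\<Union>n. \<alpha> (g i j n)))) \<and>
     ce {i. \<alpha> i \<noteq> {}}"

definition computable_open_seq :: "(nat \<Rightarrow> 'a set) \<Rightarrow> (nat \<Rightarrow> 'a set) \<Rightarrow> bool" where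
  "computable_open_seq \<alpha> \<O> \<longleftrightarrow> (\<exists>f. computable f \<and> (\<forall>n. \<O> n = (\<Union>k\<in>W (f n). \<alpha> k)))"

definition nbhd_indices :: "(nat \<Rightarrow> 'a set) \<Rightarrow> 'a \<Rightarrow> nat set" where
  "nbhd_indices \<alpha> x = {n. x \<in> \<alpha> n}"

definition computable_points :: "'a topology \<Rightarrow> (nat \<Rightarrow> 'a set) \<Rightarrow> 'a set" where
  "computable_points X \<alpha> = {x \<in> topspace X. ce (nbhd_indices \<alpha> x)}"

definition computable_point_seq :: "'a topology \<Rightarrow> (nat \<Rightarrow> 'a set) \<Rightarrow> (nat \<Rightarrow> 'a) \<Rightarrow> bool" where
  "computable_point_seq X \<alpha> a \<longleftrightarrow>
     (\<forall>n. a n \<in> computable_points X \<alpha>) \<and>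
     (\<exists>f. computable f \<and> (\<forall>n. nbhd_indices \<alpha> (a n) = W (f n)))"

definition specialisation :: "'a topology \<Rightarrow> 'a rel" where
  "specialisation X =
     {(x, y). x \<in> topspace X \<and> y \<in> topspace X \<and> (\<forall>U. openin X U \<and> x \<in> U \<longrightarrow> y \<in> U)}"

lemma partial_order_on_specialisation:
  assumes "t0_space X"
  shows "partial_order_on (topspace X) (specialisation X)"
  using assms
  unfolding partial_order_on_def preorder_on_def refl_on_def trans_def antisym_def
    specialisation_def t0_space_def
  by (safe; blast)

definition modular_T0_space :: "'a topology \<Rightarrow> (nat \<Rightarrow> 'a set) \<Rightarrow> bool" where
  "modular_T0_space X \<alpha> \<longleftrightarrow>
     effectively_enumerable X \<alpha> \<and>
     t0_space X \<and>
     wn_family (nbhd_indices \<alpha> ` computable_points X \<alpha>) \<and>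
     (\<exists>b \<O>. computable_point_seq X \<alpha> b \<and>
        computable_open_seq \<alpha> \<O> \<and>
        (\<forall>n. \<forall>y\<in>\<O> n. (b n, y) \<in> specialisation X) \<and>
        (\<forall>m. \<alpha> m = (\<Union>i\<in>{i. b i \<in> \<alpha> m}. \<O> i)))"

section \<open>Directed completeness\<close>

text \<open>
  Antisymmetry, reflexivity and transitivity are not part of \<open>directed_complete\<close>: for the
  specialisation order of a \<open>T\<^sub>0\<close> space they hold by \<open>partial_order_on_specialisation\<close>.
\<close>

definition directed :: "'a rel \<Rightarrow> 'a set \<Rightarrow> bool" where
  "directed r D \<longleftrightarrow> (\<forall>x\<in>D. \<forall>y\<in>D. \<exists>z\<in>D. (x, z) \<in> r \<and> (y, z) \<in> r)"

definition supremum_in :: "'a set \<Rightarrow> 'a rel \<Rightarrow> 'a set \<Rightarrow> 'a \<Rightarrow> bool" where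
  "supremum_in A r D s \<longleftrightarrow>
     s \<in> A \<and> (\<forall>x\<in>D. (x, s) \<in> r) \<and> (\<forall>u\<in>A. (\<forall>x\<in>D. (x, u) \<in> r) \<longrightarrow> (s, u) \<in> r)"

definition directed_complete :: "'a set \<Rightarrow> 'a rel \<Rightarrow> bool" where
  "directed_complete A r \<longleftrightarrow>
     (\<forall>D. D \<subseteq> A \<and> D \<noteq> {} \<and> directed r D \<longrightarrow> (\<exists>s. supremum_in A r D s))"

end

theory Submission
  imports Defs
begin

text \<open>
  The space consists of the c.e. sets containing \<open>0\<close>, with the Scott topology: basic open sets are
  the sets of all points above a given finite set. Its specialisation order is inclusion, and every
  point is computable. A c.e. set of codes that is the neighbourhood filter of a point \<open>A\<close> determines
  \<open>A\<close> through the codes of the sets \<open>{k, 0}\<close>, and this reading of an arbitrary c.e. set always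
  gives a point; this makes the neighbourhood filters a \<open>wn\<close>-family. The finite sets witness the
  second requirement. The finite subsets of a set \<open>M\<close> that is not c.e. form a directed family
  without supremum, since a c.e. superset of \<open>M\<close> stays one when a point outside \<open>M\<close> is removed.
\<close>

section \<open>Coding of finite sets containing \<open>0\<close> by natural numbers\<close>

definition head :: "nat \<Rightarrow> nat" where
  "head m = fst (prod_decode m)"

definition tail :: "nat \<Rightarrow> nat" where
  "tail m = snd (prod_decode m)"

definition entry :: "nat \<Rightarrow> nat \<Rightarrow> nat" where
  "entry m i = head ((tail ^^ i) m)"

text \<open>
  A number codes an infinite sequence by iterated unpairing. It is eventually \<open>0\<close>, because
  \<open>tail m < m\<close> for \<open>m \<ge> 2\<close>.
\<close>

definition entries :: "nat \<Rightarrow> nat set" where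
  "entries m = range (entry m)"

lemma head_encode [simp]: "head (prod_encode (a, b)) = a"
  and tail_encode [simp]: "tail (prod_encode (a, b)) = b"
  by (simp_all add: head_def tail_def)

lemma encode_head_tail: "prod_encode (head m, tail m) = m"
  by (simp add: head_def tail_def)

lemma entries_encode: "entries (prod_encode (a, b)) = insert a (entries b)"
proof -
  have "entry (prod_encode (a, b)) 0 = a" "entry (prod_encode (a, b)) (Suc i) = entry b i" for i
    by (simp_all add: entry_def funpow_Suc_right del: funpow.simps(2))
  then show ?thesis
    unfolding entries_def image_def by (auto, metis not0_implies_Suc, metis, metis)
qed

text \<open>Iterated unpairing becomes stationary at \<open>0\<close> and \<open>1\<close>, and
  yields the entry \<open>0\<close> from there on.\<close>

lemma head_tail_small:
  assumes "m < 2"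
  shows "head m = 0" "tail m = m"
proof -
  have "prod_encode (0, 0) = 0" "prod_encode (0, 1) = 1"
    by (simp_all add: prod_encode_def)
  then have "prod_decode 0 = (0, 0)" "prod_decode 1 = (0, 1)"
    by (metis prod_encode_inverse)+
  moreover have "m = 0 \<or> m = 1"
    using assms by linarith
  ultimately show "head m = 0" "tail m = m"
    by (auto simp: head_def tail_def)
qed

lemma le_triangle: "n \<le> triangle n"
  by (induction n) simp_all

lemma tail_less: "tail m < m" if "m \<ge> 2"
proof -
  obtain a b where m: "m = prod_encode (a, b)"
    by (metis encode_head_tail)
  show ?thesis
  proof (cases "a = 0")
    case False
    then show ?thesis
      unfolding m tail_encode using le_triangle[of "a + b"] by (simp add: prod_encode_def)
  next
    case True
    \<comment> \<open>The Cantor code of \<open>(0, b)\<close> is \<open>triangle b\<close>, which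
      exceeds \<open>b\<close> only from \<open>2\<close> on; \<open>m \<ge> 2\<close> rules out the
      two fixed points.\<close>
    have "b < triangle b" if "b \<ge> 2"
      using that by (induction b rule: dec_induct) (simp_all add: numeral_2_eq_2)
    then show ?thesis
      using that True unfolding m tail_encode
      by (cases "b \<ge> 2") (auto simp: prod_encode_def not_le less_2_cases_iff)
  qed
qed

text \<open>Unpairing lowers the number until it is below \<open>2\<close>, after which all entries
  are \<open>0\<close>. Hence \<open>m + 1\<close> entries exhaust the set, and loops over a coded
  set can be bounded.\<close>

lemma entries_bounded: "entries m = entry m ` {..m}"
proof (induction m rule: less_induct)
  case (less m)
  show ?case
  proof (cases "m < 2")
    case True
    then have "(tail ^^ i) m = m" for i
      by (induction i) (simp_all add: head_tail_small)
    then have "entry m i = 0" for i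
      using True by (simp add: entry_def head_tail_small)
    then show ?thesis
      by (auto simp: entries_def)
  next
    case False
    have Suc: "entry m (Suc i) = entry (tail m) i" for i
      by (simp add: entry_def funpow_Suc_right del: funpow.simps(2))
    have "entries m = insert (entry m 0) (entries (tail m))"
      using entries_encode[of "head m" "tail m"] by (simp add: encode_head_tail entry_def)
    also have "\<dots> = insert (entry m 0) (entry m ` Suc ` {..tail m})"
      using less False tail_less by (simp add: image_image Suc)
    also have "\<dots> \<subseteq> entry m ` {..m}"
      using False tail_less[of m] by auto
    finally show ?thesis
      by (auto simp: entries_def)
  qed
qed

lemma entries_0: "entries 0 = {0}"
  by (simp add: entries_bounded entry_def head_tail_small)

lemma entries_singleton: "entries (prod_encode (k, 0)) = {k, 0}"
  by (simp add: entries_encode entries_0)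

text \<open>Every coded sequence ends in zeros. This is why the points of the space contain
  \<open>0\<close>.\<close>

lemma zero_in_entries: "0 \<in> entries m"
proof (induction m rule: less_induct)
  case (less m)
  show ?case
  proof (cases "m < 2")
    case True
    then have "entry m 0 = 0"
      by (simp add: entry_def head_tail_small)
    then show ?thesis
      by (metis entries_def rangeI)
  next
    case False
    then show ?thesis
      using less tail_less entries_encode[of "head m" "tail m"]
      by (simp add: encode_head_tail)
  qed
qed

definition prepend :: "nat \<Rightarrow> nat \<Rightarrow> nat \<Rightarrow> nat" where
  "prepend i j = rec_nat j (\<lambda>k r. prod_encode (entry i k, r))"

definition join :: "nat \<Rightarrow> nat \<Rightarrow> nat" where
  "join i j = prepend i j (Suc i)"

lemma entries_prepend: "entries (prepend i j n) = entry i ` {..<n} \<union> entries j"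
  by (induction n) (simp_all add: prepend_def entries_encode lessThan_Suc)

lemma entries_join: "entries (join i j) = entries i \<union> entries j"
  by (simp add: join_def entries_prepend entries_bounded[of i] lessThan_Suc_atMost)

section \<open>Programs for working with codes, and c.e. sets\<close>

lemma W_goedel: "W (goedel p) = dom (eval p)"
  by (simp add: W_def inj_goedel inj_def)

lemma ce_dom: "ce (dom (eval p))"
  by (metis W_goedel ce_def)

definition I_prog :: prog where
  "I_prog = Pr Fst Snd"

definition entry_prog :: prog where
  "entry_prog = Comp Fst (PrimRec I_prog (Comp Snd (Comp Snd Snd)))"

text \<open>Only \<open>(0, 0)\<close> has Cantor code \<open>0\<close>, so pairing both truncated
  differences gives a zero exactly at equality, the form of test that \<open>Mu\<close> searches
  for.\<close>

definition eq_prog :: prog where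
  "eq_prog =
    (let pred = Comp (PrimRec Zero (Comp Fst Snd)) (Pr I_prog I_prog);
         sub = PrimRec I_prog (Comp pred (Comp Snd Snd))
     in Pr sub (Comp sub (Pr Snd Fst)))"

definition sgn_prog :: prog where
  "sgn_prog = Comp (PrimRec Zero (Comp Succ Zero)) (Pr I_prog I_prog)"

definition is_zero_prog :: prog where
  "is_zero_prog = Comp (PrimRec (Comp Succ Zero) Zero) (Pr I_prog I_prog)"

definition member_prog :: prog where
  "member_prog = Mu (Comp eq_prog (Pr (Comp Fst Fst) (Comp entry_prog (Pr (Comp Snd Fst) Snd))))"

text \<open>Only definedness matters here: the values are discarded, and divergence in one round
  carries through to the end. \<open>Succ\<close> supplies the number of rounds,
  \<open>m + 1\<close> on input \<open>m\<close>.\<close>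

definition loop_prog :: "prog \<Rightarrow> prog" where
  "loop_prog p =
    Comp (PrimRec Zero (Comp p (Comp entry_prog (Pr Fst (Comp Fst Snd))))) (Pr I_prog Succ)"

text \<open>A guarded call: the recursion runs \<open>p x\<close> only when \<open>x\<close> is nonzero.\<close>

definition guard_prog :: "prog \<Rightarrow> prog" where
  "guard_prog p = Comp (PrimRec Zero (Comp p Fst)) (Pr I_prog sgn_prog)"

primrec const_prog :: "nat \<Rightarrow> prog" where
  "const_prog 0 = Zero"
| "const_prog (Suc n) = Comp Succ (const_prog n)"

lemma eval_I_prog [simp]: "eval I_prog x = Some x"
  by (simp add: I_prog_def)

lemma eval_const_prog [simp]: "eval (const_prog n) x = Some n"
  by (induction n) simp_all

lemma eval_entry_prog [simp]: "eval entry_prog (prod_encode (m, i)) = Some (entry m i)"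
proof -
  have "eval (PrimRec I_prog (Comp Snd (Comp Snd Snd))) (prod_encode (m, i)) = Some ((tail ^^ i) m)"
    by (induction i) (simp_all add: tail_def)
  then show ?thesis
    by (simp add: entry_prog_def entry_def head_def)
qed

lemma eval_eq_prog: "\<exists>z. eval eq_prog (prod_encode (x, y)) = Some z \<and> (z = 0 \<longleftrightarrow> x = y)"
proof -
  define pred where "pred = Comp (PrimRec Zero (Comp Fst Snd)) (Pr I_prog I_prog)"
  define sub where "sub = PrimRec I_prog (Comp pred (Comp Snd Snd))"
  have pred: "eval pred x = Some (x - 1)" for x
  proof -
    have "eval (PrimRec Zero (Comp Fst Snd)) (prod_encode (a, x)) = Some (x - 1)" for a
      by (induction x) simp_all
    then show ?thesis by (simp add: pred_def)
  qed
  have sub: "eval sub (prod_encode (x, y)) = Some (x - y)" for x y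
    by (induction y) (simp_all add: sub_def pred)
  have "eval eq_prog (prod_encode (x, y)) = Some (prod_encode (x - y, y - x))"
    unfolding eq_prog_def Let_def pred_def[symmetric] sub_def[symmetric] by (simp add: sub)
  moreover have "prod_encode (a, b) = 0 \<longleftrightarrow> a = 0 \<and> b = 0" for a b
    using le_triangle[of b] by (auto simp: prod_encode_def)
  ultimately show ?thesis by auto
qed

lemma eval_sgn_prog: "eval sgn_prog x = Some (if x = 0 then 0 else 1)"
proof -
  have "eval (PrimRec Zero (Comp Succ Zero)) (prod_encode (a, x)) = Some (if x = 0 then 0 else 1)" for a
    by (induction x) simp_all
  then show ?thesis by (simp add: sgn_prog_def)
qed

lemma eval_is_zero_prog: "eval is_zero_prog x = Some (if x = 0 then 1 else 0)"
proof -
  have "eval (PrimRec (Comp Succ Zero) Zero) (prod_encode (a, x)) = Some (if x = 0 then 1 else 0)" for a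
    by (induction x) simp_all
  then show ?thesis by (simp add: is_zero_prog_def)
qed

lemma dom_Mu_total:
  assumes "\<And>y. eval p (prod_encode (a, y)) \<noteq> None"
  shows "a \<in> dom (eval (Mu p)) \<longleftrightarrow> (\<exists>y. eval p (prod_encode (a, y)) = Some 0)"
  using assms by (auto simp: dom_def)

lemma member_prog_dom: "prod_encode (k, n) \<in> dom (eval member_prog) \<longleftrightarrow> k \<in> entries n"
proof -
  define p where
    "p = Comp eq_prog (Pr (Comp Fst Fst) (Comp entry_prog (Pr (Comp Snd Fst) Snd)))"
  have p: "eval p (prod_encode (prod_encode (k, n), i)) = eval eq_prog (prod_encode (k, entry n i))" for i
    by (simp add: p_def)
  have p_zero: "eval p (prod_encode (prod_encode (k, n), i)) = Some 0 \<longleftrightarrow> k = entry n i"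
    and p_total: "eval p (prod_encode (prod_encode (k, n), i)) \<noteq> None" for i
    using eval_eq_prog[of k "entry n i"] by (auto simp: p)
  have "prod_encode (k, n) \<in> dom (eval (Mu p)) \<longleftrightarrow> (\<exists>i. k = entry n i)"
    by (subst dom_Mu_total) (use p_total p_zero in blast)+
  then show ?thesis
    by (auto simp: member_prog_def p_def entries_def)
qed

lemma dom_loop_prog: "dom (eval (loop_prog p)) = {m. entries m \<subseteq> dom (eval p)}"
proof -
  have loop: "eval (PrimRec Zero (Comp p (Comp entry_prog (Pr Fst (Comp Fst Snd))))) (prod_encode (m, n)) \<noteq> None
    \<longleftrightarrow> entry m ` {..<n} \<subseteq> dom (eval p)" (is "?R n \<noteq> None \<longleftrightarrow> _") for m n
  proof (induction n)
    case (Suc n)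
    have "?R (Suc n) = Option.bind (?R n) (\<lambda>v. eval p (entry m n))"
      by simp
    then show ?case
      using Suc by (cases "?R n") (auto simp: lessThan_Suc)
  qed simp
  have "m \<in> dom (eval (loop_prog p)) \<longleftrightarrow> entries m \<subseteq> dom (eval p)" for m
    using loop[of m "Suc m"]
    by (simp add: loop_prog_def entries_bounded lessThan_Suc_atMost domIff del: eval.simps(7))
  then show ?thesis by blast
qed

lemma dom_guard_prog: "dom (eval (guard_prog p)) = insert 0 (dom (eval p))"
proof -
  have "x \<in> dom (eval (guard_prog p)) \<longleftrightarrow> x = 0 \<or> x \<in> dom (eval p)" for x
    by (cases "x = 0") (auto simp: guard_prog_def eval_sgn_prog domIff)
  then show ?thesis by blast
qed

text \<open>An equality test makes the complement of \<open>{x}\<close> c.e., and \<open>Pr\<close>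
  halts exactly where both components do. This serves to shrink an alleged supremum.\<close>

lemma ce_remove:
  assumes "ce A"
  shows "ce (A - {x})"
proof -
  obtain p where A: "A = dom (eval p)"
    using assms by (auto simp: ce_def W_def)
  \<comment> \<open>The value of \<open>r\<close> does not depend on the search variable, so
    \<open>Mu r\<close> stops at once or never.\<close>
  define r where "r = Comp is_zero_prog (Comp eq_prog (Pr Fst (const_prog x)))"
  have r: "\<exists>z. eval r (prod_encode (y, i)) = Some z \<and> (z = 0 \<longleftrightarrow> y \<noteq> x)" for y i
    using eval_eq_prog[of y x] by (auto simp: r_def eval_is_zero_prog)
  have r_zero: "eval r (prod_encode (y, i)) = Some 0 \<longleftrightarrow> y \<noteq> x"
    and r_total: "eval r (prod_encode (y, i)) \<noteq> None" for y i
    using r[of y i] by auto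
  have "y \<in> dom (eval (Mu r)) \<longleftrightarrow> y \<noteq> x" for y
    by (subst dom_Mu_total) (simp_all only: r_zero r_total, simp_all)
  then have mu: "dom (eval (Mu r)) = - {x}"
    by blast
  have "dom (eval (Pr p (Mu r))) = dom (eval p) \<inter> dom (eval (Mu r))"
    by (auto simp: dom_def bind_eq_Some_conv simp del: eval.simps(8))
  then have "dom (eval (Pr p (Mu r))) = A - {x}"
    by (simp only: mu A) blast
  then show ?thesis
    by (metis ce_dom)
qed

section \<open>Computable functions and the numbers of uniformly built programs\<close>

lemma computableI: "(\<And>x. eval p x = Some (f x)) \<Longrightarrow> computable f"
  unfolding computable_def partial_computable_def by (metis ext)

lemma computableE:
  assumes "computable f"
  obtains p where "\<And>x. eval p x = Some (f x)"
  using assms unfolding computable_def partial_computable_def by metis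

lemma computable_id: "computable (\<lambda>x. x)"
  by (rule computableI[of I_prog]) simp

lemma computable_const: "computable (\<lambda>x. c)"
  by (rule computableI[of "const_prog c"]) simp

lemma computable_pair:
  assumes "computable f" "computable g"
  shows "computable (\<lambda>x. prod_encode (f x, g x))"
proof -
  obtain p q where "\<And>x. eval p x = Some (f x)" "\<And>x. eval q x = Some (g x)"
    using assms by (metis computableE)
  then show ?thesis
    by (intro computableI[of "Pr p q"]) simp
qed

lemma computable_affine:
  assumes "computable f"
  shows "computable (\<lambda>x. 4 * f x + c)"
proof -
  obtain p where p: "\<And>x. eval p x = Some (f x)"
    using assms by (metis computableE)
  define q where
    "q = PrimRec (const_prog c) (Comp Succ (Comp Succ (Comp Succ (Comp Succ (Comp Snd Snd)))))"
  have q: "eval q (prod_encode (a, n)) = Some (4 * n + c)" for a n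
    by (induction n) (simp_all add: q_def)
  show ?thesis
    by (rule computableI[of "Comp q (Pr p p)"]) (simp add: p q)
qed

text \<open>This and the next rules do the work of the s-m-n theorem: \<open>goedel\<close> is
  arithmetic in the numbers of the parts, so a program built uniformly from parameters has a
  computable number.\<close>

lemma computable_goedel_Pr:
  assumes "computable (\<lambda>n. goedel (P n))" "computable (\<lambda>n. goedel (Q n))"
  shows "computable (\<lambda>n. goedel (Pr (P n) (Q n)))"
  unfolding goedel.simps by (intro computable_affine computable_pair assms)

lemma computable_goedel_Comp:
  assumes "computable (\<lambda>n. goedel (P n))" "computable (\<lambda>n. goedel (Q n))"
  shows "computable (\<lambda>n. goedel (Comp (P n) (Q n)))"
  unfolding goedel.simps by (intro computable_affine computable_pair assms)

lemma computable_goedel_PrimRec: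
  assumes "computable (\<lambda>n. goedel (P n))" "computable (\<lambda>n. goedel (Q n))"
  shows "computable (\<lambda>n. goedel (PrimRec (P n) (Q n)))"
  unfolding goedel.simps by (intro computable_affine computable_pair assms)

lemma computable_goedel_const_prog: "computable (\<lambda>n. goedel (const_prog n))"
proof -
  \<comment> \<open>As \<open>goedel Succ = 1\<close>, \<open>p\<close> leads from the number of
    \<open>const_prog n\<close> to that of \<open>const_prog (Suc n)\<close>.\<close>
  obtain p where p: "\<And>x. eval p x = Some (4 * prod_encode (1, x) + 5)"
    by (rule computableE[OF computable_affine[OF computable_pair[OF computable_const computable_id]]])
      blast
  define q where "q = PrimRec Zero (Comp p (Comp Snd Snd))"
  have q: "eval q (prod_encode (a, n)) = Some (goedel (const_prog n))" for a n
    by (induction n) (simp_all add: q_def p)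
  show ?thesis
    by (rule computableI[of "Comp q (Pr I_prog I_prog)"]) (simp add: q)
qed

lemma computable_goedel_loop_prog:
  assumes "computable (\<lambda>n. goedel (P n))"
  shows "computable (\<lambda>n. goedel (loop_prog (P n)))"
  unfolding loop_prog_def
  by (intro computable_goedel_Comp computable_goedel_PrimRec assms computable_const)

lemma computable_goedel_guard_prog:
  assumes "computable (\<lambda>n. goedel (P n))"
  shows "computable (\<lambda>n. goedel (guard_prog (P n)))"
  unfolding guard_prog_def
  by (intro computable_goedel_Comp computable_goedel_PrimRec assms computable_const)

text \<open>Two basic open sets meet in a single basic one, so the sequence of indices is constant
  in \<open>n\<close>.\<close>

lemma computable3_join: "computable3 (\<lambda>i j n. join i j)"
proof -
  define q where
    "q = PrimRec Snd (Pr (Comp entry_prog (Pr (Comp Fst Fst) (Comp Fst Snd))) (Comp Snd Snd))"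
  have q: "eval q (prod_encode (prod_encode (i, j), n)) = Some (prepend i j n)" for i j n
    by (induction n) (simp_all add: q_def prepend_def)
  \<comment> \<open>The input \<open>(i, (j, n))\<close> is rearranged into
    \<open>((i, j), Suc i)\<close>.\<close>
  define p where "p = Comp q (Pr (Pr Fst (Comp Fst Snd)) (Comp Succ Fst))"
  have "eval p x = Some (join (head x) (head (tail x)))" for x
    by (simp add: p_def q join_def head_def tail_def)
  then have "computable (\<lambda>x. join (head x) (head (tail x)))"
    by (rule computableI)
  moreover have "\<forall>i j n. join i j = (\<lambda>x. join (head x) (head (tail x))) (prod_encode (i, prod_encode (j, n)))"
    by simp
  ultimately show ?thesis
    unfolding computable3_def by blast
qed

section \<open>The space of c.e. sets containing \<open>0\<close> and its specialisation
  order\<close>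

definition basic_open :: "nat \<Rightarrow> nat set set" where
  "basic_open m = {A. ce A \<and> entries m \<subseteq> A}"

definition ce_space :: "nat set topology" where
  "ce_space = topology (arbitrary union_of (\<lambda>U. U \<in> range basic_open))"

lemma basic_open_Int: "basic_open i \<inter> basic_open j = basic_open (join i j)"
  by (auto simp: basic_open_def entries_join)

lemma enumerated_base_ce_space: "enumerated_base ce_space basic_open"
proof -
  have "istopology (arbitrary union_of (\<lambda>U. U \<in> range basic_open))"
    by (rule istopology_base) (auto simp: basic_open_Int)
  then show ?thesis
    by (simp add: enumerated_base_def ce_space_def topology_inverse')
qed

lemma openin_basic_open: "openin ce_space (basic_open m)"
  using enumerated_base_ce_space unfolding enumerated_base_def
  by (simp add: arbitrary_union_of_inc)

lemma openin_ce_space_upward: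
  assumes "openin ce_space U" "A \<in> U" "A \<subseteq> B" "ce B"
  shows "B \<in> U"
  using assms enumerated_base_ce_space
  unfolding enumerated_base_def union_of_def arbitrary_def
  by (fastforce simp: basic_open_def)

text \<open>The number \<open>0\<close> codes \<open>{0}\<close>, so \<open>basic_open 0\<close> is
  already the whole space.\<close>

lemma topspace_ce_space: "topspace ce_space = {A. ce A \<and> 0 \<in> A}"
proof -
  have "topspace ce_space = \<Union> (range basic_open)"
  proof
    show "topspace ce_space \<subseteq> \<Union> (range basic_open)"
      using openin_topspace[of ce_space] enumerated_base_ce_space
      unfolding enumerated_base_def union_of_def arbitrary_def by fastforce
    show "\<Union> (range basic_open) \<subseteq> topspace ce_space"
      using openin_basic_open openin_subset by blast
  qed
  also have "\<dots> = {A. ce A \<and> 0 \<in> A}"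
  proof
    show "\<Union> (range basic_open) \<subseteq> {A. ce A \<and> 0 \<in> A}"
      using zero_in_entries by (auto simp: basic_open_def)
    show "{A. ce A \<and> 0 \<in> A} \<subseteq> \<Union> (range basic_open)"
      using entries_0 by (auto simp: basic_open_def intro!: exI[of _ 0])
  qed
  finally show ?thesis .
qed

text \<open>Open sets are upward closed under inclusion among c.e. sets; conversely, the basic open
  set of a code of \<open>{k, 0}\<close> tests whether a point contains \<open>k\<close>.\<close>

lemma specialisation_ce_space:
  "(A, B) \<in> specialisation ce_space \<longleftrightarrow> ce A \<and> ce B \<and> 0 \<in> A \<and> A \<subseteq> B" (is "?L \<longleftrightarrow> ?R")
proof
  assume L: ?L
  then have A: "ce A" "0 \<in> A" and B: "ce B"
    by (auto simp: specialisation_def topspace_ce_space)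
  have "k \<in> B" if "k \<in> A" for k
  proof -
    have "A \<in> basic_open (prod_encode (k, 0))"
      using A that by (simp add: basic_open_def entries_singleton)
    then have "B \<in> basic_open (prod_encode (k, 0))"
      using L openin_basic_open by (auto simp: specialisation_def)
    then show ?thesis
      by (simp add: basic_open_def entries_singleton)
  qed
  with A B show ?R by blast
next
  assume ?R
  then show ?L
    using openin_ce_space_upward by (auto simp: specialisation_def topspace_ce_space)
qed

lemma t0_space_ce_space: "t0_space ce_space"
proof -
  have "A = B" if "A \<in> topspace ce_space" "B \<in> topspace ce_space"
    "\<And>U. openin ce_space U \<Longrightarrow> A \<in> U \<longleftrightarrow> B \<in> U" for A B
  proof -
    have "(A, B) \<in> specialisation ce_space" "(B, A) \<in> specialisation ce_space"
      using that by (auto simp: specialisation_def)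
    then show ?thesis
      by (auto simp: specialisation_ce_space)
  qed
  then show ?thesis
    unfolding t0_space_def by blast
qed

section \<open>Computable points and the \<open>wn\<close>-family condition\<close>

lemma nbhd_indices_basic_open: "ce A \<Longrightarrow> nbhd_indices basic_open A = {m. entries m \<subseteq> A}"
  by (simp add: nbhd_indices_def basic_open_def)

lemma ce_nbhd_indices:
  assumes "ce A"
  shows "ce (nbhd_indices basic_open A)"
proof -
  obtain p where "A = dom (eval p)"
    using assms by (auto simp: ce_def W_def)
  then have "nbhd_indices basic_open A = dom (eval (loop_prog p))"
    using assms by (simp add: nbhd_indices_basic_open dom_loop_prog)
  then show ?thesis
    using ce_dom by simp
qed

lemma computable_points_ce_space: "computable_points ce_space basic_open = {A. ce A \<and> 0 \<in> A}"
  by (auto simp: computable_points_def topspace_ce_space ce_nbhd_indices)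

lemma wn_family_ce_space: "wn_family (nbhd_indices basic_open ` computable_points ce_space basic_open)"
proof -
  \<comment> \<open>From inside out: program \<open>n\<close> is run on the code of
    \<open>{k, 0}\<close>, \<open>guard_prog\<close> adjoins \<open>0\<close> so that the domain is
    a point whatever \<open>W n\<close> is, and \<open>loop_prog\<close> passes to the neighbourhood
    filter of that point. So \<open>\<sigma>\<close> is total.\<close>
  define \<sigma> where
    "\<sigma> n = goedel (loop_prog (guard_prog (Comp (inv goedel n) (Pr I_prog Zero))))" for n
  define pt where "pt n = insert 0 {k. prod_encode (k, 0) \<in> W n}" for n
  \<comment> \<open>By surjectivity of \<open>goedel\<close> this is the identity; it is the base
    case for the closure rules.\<close>
  have "computable (\<lambda>n. goedel (inv goedel n))"
    by (simp add: surj_f_inv_f bij_is_surj[OF bij_goedel] computable_id)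
  then have "computable \<sigma>"
    unfolding \<sigma>_def
    by (intro computable_goedel_loop_prog computable_goedel_guard_prog computable_goedel_Comp
        computable_const)
  then have "partial_computable (\<lambda>n. Some (\<sigma> n))"
    by (simp add: computable_def)
  moreover have dom_pt: "pt n = dom (eval (guard_prog (Comp (inv goedel n) (Pr I_prog Zero))))" for n
    unfolding pt_def dom_guard_prog by (auto simp: W_def)
  have ce_pt: "ce (pt n)" for n
    unfolding dom_pt by (rule ce_dom)
  have W_sigma: "W (\<sigma> n) = nbhd_indices basic_open (pt n)" for n
    by (simp add: \<sigma>_def W_goedel dom_loop_prog nbhd_indices_basic_open[OF ce_pt] flip: dom_pt)
  moreover have "W (\<sigma> n) \<in> nbhd_indices basic_open ` computable_points ce_space basic_open" for n
    using ce_pt by (auto simp: W_sigma computable_points_ce_space pt_def)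
  moreover have "W (\<sigma> n) = W n" if "W n \<in> nbhd_indices basic_open ` computable_points ce_space basic_open" for n
  proof -
    obtain A where A: "ce A" "0 \<in> A" "W n = nbhd_indices basic_open A"
      using \<open>W n \<in> _\<close> by (auto simp: computable_points_ce_space)
    \<comment> \<open>Since \<open>0 \<in> A\<close>, the set \<open>{k, 0}\<close> lies in
      \<open>A\<close> exactly when \<open>k\<close> does.\<close>
    then have "pt n = A"
      by (auto simp: pt_def nbhd_indices_basic_open entries_singleton)
    then show ?thesis
      by (simp add: W_sigma A)
  qed
  ultimately show ?thesis
    unfolding wn_family_def
    by (auto simp: computable_points_ce_space ce_nbhd_indices intro!: exI[of _ "\<lambda>n. Some (\<sigma> n)"])
qed

section \<open>The two sequences of the second requirement\<close>

lemma dom_section: "dom (eval (Comp p (Pr I_prog (const_prog n)))) = {x. prod_encode (x, n) \<in> dom (eval p)}"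
  by auto

lemma dom_member_section: "dom (eval (Comp member_prog (Pr I_prog (const_prog n)))) = entries n"
  by (simp only: dom_section member_prog_dom Collect_mem_eq)

lemma ce_entries: "ce (entries n)"
  by (metis dom_member_section ce_dom)

lemma computable_point_seq_entries: "computable_point_seq ce_space basic_open entries"
proof -
  \<comment> \<open>Freezing the second argument of \<open>member_prog\<close> at \<open>n\<close>
    by \<open>const_prog\<close> semi-decides \<open>entries n\<close> uniformly in
    \<open>n\<close>.\<close>
  define f where
    "f n = goedel (loop_prog (Comp member_prog (Pr I_prog (const_prog n))))" for n
  have "computable f"
    unfolding f_def
    by (intro computable_goedel_loop_prog computable_goedel_Comp computable_goedel_Pr
        computable_goedel_const_prog computable_const)
  moreover have "nbhd_indices basic_open (entries n) = W (f n)" for n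
    by (simp only: f_def W_goedel dom_loop_prog dom_member_section nbhd_indices_basic_open[OF ce_entries])
  ultimately show ?thesis
    by (auto simp: computable_point_seq_def computable_points_ce_space ce_entries zero_in_entries)
qed

lemma computable_open_seq_basic_open: "computable_open_seq basic_open basic_open"
proof -
  \<comment> \<open>On \<open>(k, n)\<close> the search succeeds at once if \<open>k = n\<close> and
    never otherwise, so \<open>W (f n)\<close> will be \<open>{n}\<close>.\<close>
  define r where "r = Mu (Comp eq_prog Fst)"
  define f where "f n = goedel (Comp r (Pr I_prog (const_prog n)))" for n
  have "computable f"
    unfolding f_def
    by (intro computable_goedel_Comp computable_goedel_Pr computable_goedel_const_prog
        computable_const)
  moreover have "prod_encode (k, n) \<in> dom (eval r) \<longleftrightarrow> k = n" for k n
  proof -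
    have "eval (Comp eq_prog Fst) (prod_encode (prod_encode (k, n), i)) = Some 0 \<longleftrightarrow> k = n"
      and "eval (Comp eq_prog Fst) (prod_encode (prod_encode (k, n), i)) \<noteq> None" for i
      using eval_eq_prog[of k n] by auto
    then show ?thesis
      unfolding r_def by (subst dom_Mu_total) simp_all
  qed
  then have "W (f n) = {n}" for n
    unfolding f_def W_goedel dom_section by simp
  ultimately show ?thesis
    unfolding computable_open_seq_def by auto
qed

text \<open>The point \<open>entries m\<close> is the least element of \<open>basic_open m\<close>,
  so the coded finite sets and the basic open sets themselves serve as the two sequences.\<close>

lemma modular_T0_space_ce_space: "modular_T0_space ce_space basic_open"
proof -
  have "basic_open i \<noteq> {}" for i
    using ce_entries by (auto simp: basic_open_def)
  then have "ce {i. basic_open i \<noteq> {}}"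
    using ce_dom[of Zero] by (simp add: dom_def)
  moreover have "\<forall>i j. basic_open i \<inter> basic_open j = (\<Union>n. basic_open ((\<lambda>i j n. join i j) i j n))"
    by (simp add: basic_open_Int)
  ultimately have "effectively_enumerable ce_space basic_open"
    unfolding effectively_enumerable_def
    using enumerated_base_ce_space computable3_join by blast
  moreover have "\<forall>n. \<forall>y\<in>basic_open n. (entries n, y) \<in> specialisation ce_space"
    using zero_in_entries ce_entries by (auto simp: specialisation_ce_space basic_open_def)
  moreover have "\<forall>m. basic_open m = (\<Union>i\<in>{i. entries i \<in> basic_open m}. basic_open i)"
    using ce_entries by (fastforce simp: basic_open_def)
  ultimately show ?thesis
    unfolding modular_T0_space_def
    using t0_space_ce_space wn_family_ce_space computable_point_seq_entries
      computable_open_seq_basic_open by blast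
qed

section \<open>Failure of directed completeness\<close>

text \<open>
  Diagonalisation; adjoining \<open>0\<close> is harmless because the programs with numbers \<open>0\<close> and \<open>1\<close> are total.
\<close>

lemma not_ce_diagonal: "\<not> ce (insert 0 {n. n \<notin> W n})"
proof
  assume "ce (insert 0 {n. n \<notin> W n})"
  then obtain e where e: "insert 0 {n. n \<notin> W n} = W e"
    by (auto simp: ce_def)
  \<comment> \<open>For \<open>e\<close> other than \<open>0\<close> the usual contradiction arises.
    If \<open>e = 0\<close>, the set would be everything, yet \<open>1\<close> is missing because
    \<open>1 \<in> W 1\<close>.\<close>
  then have "e = 0"
    by blast
  moreover have "W 0 = UNIV" "W 1 = UNIV"
    using W_goedel[of Zero] W_goedel[of Succ] by (auto simp: dom_def)
  ultimately show False
    using e by (metis UNIV_I insertE mem_Collect_eq zero_neq_one)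
qed

lemma not_directed_complete_ce_space:
  "\<not> directed_complete (topspace ce_space) (specialisation ce_space)"
proof
  assume complete: "directed_complete (topspace ce_space) (specialisation ce_space)"
  define M where "M = insert 0 {n. n \<notin> W n}"
  \<comment> \<open>Joins of codes make this family directed, and the codes of \<open>{k, 0}\<close>
    with \<open>k \<in> M\<close> make its union all of \<open>M\<close>.\<close>
  define \<D> where "\<D> = entries ` {m. entries m \<subseteq> M}"
  have "\<D> \<subseteq> topspace ce_space"
    by (auto simp: \<D>_def topspace_ce_space ce_entries zero_in_entries)
  moreover have "entries 0 \<in> \<D>"
    unfolding \<D>_def by (rule imageI) (simp add: entries_0 M_def)
  moreover have "directed (specialisation ce_space) \<D>"
    unfolding directed_def
  proof (intro ballI)
    fix A B assume "A \<in> \<D>" "B \<in> \<D>"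
    then obtain i j where ij: "A = entries i" "B = entries j" "entries i \<union> entries j \<subseteq> M"
      by (auto simp: \<D>_def)
    then have "entries (join i j) \<subseteq> M"
      by (simp add: entries_join)
    then have "entries (join i j) \<in> \<D>"
      by (simp add: \<D>_def)
    moreover have "(A, entries (join i j)) \<in> specialisation ce_space"
      and "(B, entries (join i j)) \<in> specialisation ce_space"
      using ij ce_entries zero_in_entries
      by (simp_all only: specialisation_ce_space) (auto simp: entries_join)
    ultimately show "\<exists>C\<in>\<D>. (A, C) \<in> specialisation ce_space \<and> (B, C) \<in> specialisation ce_space"
      by blast
  qed
  ultimately obtain S where S: "supremum_in (topspace ce_space) (specialisation ce_space) \<D> S"
    using complete unfolding directed_complete_def by blast
  then have ce_S: "ce S" and zero_S: "0 \<in> S" and upper: "\<And>A. A \<in> \<D> \<Longrightarrow> A \<subseteq> S"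
    by (auto simp: supremum_in_def topspace_ce_space specialisation_ce_space)
  have "M \<subseteq> S"
  proof
    fix k assume "k \<in> M"
    then have "entries (prod_encode (k, 0)) \<in> \<D>"
      unfolding \<D>_def by (intro imageI) (simp add: entries_singleton M_def)
    then show "k \<in> S"
      using upper by (fastforce simp: entries_singleton)
  qed
  moreover have "M \<noteq> S"
    using not_ce_diagonal ce_S by (auto simp: M_def)
  ultimately obtain x where x: "x \<in> S" "x \<notin> M"
    by blast
  \<comment> \<open>All members of \<open>\<D>\<close> lie in \<open>M\<close>, which contains
    \<open>0\<close> but not \<open>x\<close>. So \<open>U\<close> is still a point and an upper
    bound, and leastness of \<open>S\<close> would give \<open>S \<subseteq> U\<close>.\<close>
  define U where "U = S - {x}"
  have U: "ce U" "0 \<in> U"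
    using ce_S zero_S x by (auto simp: U_def M_def ce_remove)
  moreover have "(A, U) \<in> specialisation ce_space" if "A \<in> \<D>" for A
    using that U x upper[OF that]
    by (auto simp: \<D>_def specialisation_ce_space ce_entries zero_in_entries U_def)
  ultimately have "(S, U) \<in> specialisation ce_space"
    using S by (auto simp: supremum_in_def topspace_ce_space)
  then show False
    using x by (auto simp: specialisation_ce_space U_def)
qed

theorem theorem4p7:
  shows "\<exists>(X :: nat set topology) (\<alpha> :: nat \<Rightarrow> nat set set).
    modular_T0_space X \<alpha> \<and> \<not> directed_complete (topspace X) (specialisation X)"
  using modular_T0_space_ce_space not_directed_complete_ce_space by blast

end
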